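(* Suppose $n\geq 3$ is an integer. Every set of $n-2$ mutually orthogonal quantum Latin squares of order $n$ is classical. Thus, $M(n)\leq n-3$.
   Context: A quantum Latin square of order $n$ is an $n\times n$ matrix $\Psi=(\psi_{ij})$ with entries in $\mathbb{C}^n$ such that the entries of each row and the entries of each column form an orthonormal basis of $\mathbb{C}^n$. Two quantum Latin squares $(\psi_{ij})_{1\le i,j\le n}$ and $(\phi_{ij})_{1\le i,j\le n}$ of order $n$ are orthogonal if $\{\psi_{ij}\otimes\phi_{ij} : i,j\in\{1,\dots,n\}\}$ is an orthonormal basis of $\mathbb{C}^n\otimes\mathbb{C}^n$. A set of $t$ mutually orthogonal quantum Latin squares of order $n$ is a set of $t$ quantum Latin squares of order $n$ any two (distinct) of which are orthogonal (for $t=1$, a single quantum Latin square). Two sets of $t$ mutually orthogonal quantum Latin squares of order $n$ are isotopic if they can be obtained from one another by (i) multiplying each entry by a phase factor (a complex number of modulus one, which may depend on the entry), (ii) permuting rows and columns, simultaneously among all squares, and (iii) applying, separately to each square, a unitary transformation of $\mathbb{C}^n$ to all of its entries. Fix an orthonormal basis $\{|1\rangle,\dots,|n\rangle\}$ of $\mathbb{C}^n$. A set of $t$ mutually orthogonal quantum Latin squares of order $n$ is classical if it is isotopic to a set in which all entries of all squares are contained in $\{|1\rangle,\dots,|n\rangle\}$ (this does not depend on the chosen basis); otherwise it is non-classical. $M(n)$ denotes the largest $t$ such that a non-classical set of $t$ mutually orthogonal quantum Latin squares of order $n$ exists, and $M(n)=0$ if no such set exists for any $t$. *)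

theory Defs
  imports
    "Jordan_Normal_Form.Schur_Decomposition"
    "Jordan_Normal_Form.VS_Connect"
    "HOL-Combinatorics.Permutations"
begin

definition orthonormal_basis :: "nat \<Rightarrow> complex vec set \<Rightarrow> bool" where
  "orthonormal_basis d B \<longleftrightarrow>
     vectorspace.basis class_ring (module_vec TYPE(complex) d) B \<and>
     (\<forall>u\<in>B. \<forall>v\<in>B. u \<bullet>c v = (if u = v then 1 else 0))"

definition unitary_mat :: "nat \<Rightarrow> complex mat \<Rightarrow> bool" where
  "unitary_mat n U \<longleftrightarrow>
     U \<in> carrier_mat n n \<and> U * mat_adjoint U = 1\<^sub>m n \<and> mat_adjoint U * U = 1\<^sub>m n"

text \<open>Kronecker model of the tensor product: the tensor product of the spaces of dimensions \<open>m\<close>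
  and \<open>n\<close> is the space of dimension \<open>m * n\<close>, where the tensor product of the \<open>a\<close>-th and the \<open>b\<close>-th
  standard basis vector is the standard basis vector with index \<open>a * n + b\<close>.\<close>

definition tensor_vec :: "complex vec \<Rightarrow> complex vec \<Rightarrow> complex vec" (infixr "\<otimes>\<^sub>v" 70) where
  "u \<otimes>\<^sub>v v = vec (dim_vec u * dim_vec v) (\<lambda>k. u $ (k div dim_vec v) * v $ (k mod dim_vec v))"

text \<open>Matrices are indexed from \<open>0\<close>. The entries of a row (column) are collected as a set; since a
  basis has \<open>n\<close> elements, repeated entries are excluded, and likewise in the definition of
  orthogonality.\<close>

definition quantum_latin_square :: "nat \<Rightarrow> complex vec mat \<Rightarrow> bool" where
  "quantum_latin_square n \<Psi> \<longleftrightarrow>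
     \<Psi> \<in> carrier_mat n n \<and>
     (\<forall>i<n. orthonormal_basis n {\<Psi> $$ (i, j) | j. j < n}) \<and>
     (\<forall>j<n. orthonormal_basis n {\<Psi> $$ (i, j) | i. i < n})"

definition orthogonal_qls :: "nat \<Rightarrow> complex vec mat \<Rightarrow> complex vec mat \<Rightarrow> bool" where
  "orthogonal_qls n \<Psi> \<Phi> \<longleftrightarrow>
     orthonormal_basis (n * n) {\<Psi> $$ (i, j) \<otimes>\<^sub>v \<Phi> $$ (i, j) | i j. i < n \<and> j < n}"

definition moqls :: "nat \<Rightarrow> nat \<Rightarrow> complex vec mat set \<Rightarrow> bool" where
  "moqls n t S \<longleftrightarrow>
     finite S \<and> card S = t \<and>
     (\<forall>\<Psi>\<in>S. quantum_latin_square n \<Psi>) \<and>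
     (\<forall>\<Psi>\<in>S. \<forall>\<Phi>\<in>S. \<Psi> \<noteq> \<Phi> \<longrightarrow> orthogonal_qls n \<Psi> \<Phi>)"

text \<open>Any sequence of the operations (phases, row and column permutations common to all squares,
  one unitary per square) can be normalised to a single application of each: \<open>\<sigma>\<close> and \<open>\<tau>\<close> permute
  rows and columns, \<open>U \<Psi>\<close> is the unitary used for the square \<open>\<Psi>\<close>, and \<open>c \<Psi> i j\<close> are the phases.\<close>

definition isotopic :: "nat \<Rightarrow> nat \<Rightarrow> complex vec mat set \<Rightarrow> complex vec mat set \<Rightarrow> bool" where
  "isotopic n t S T \<longleftrightarrow>
     moqls n t S \<and> moqls n t T \<and>
     (\<exists>\<sigma> \<tau> U c.
        \<sigma> permutes {..<n} \<and> \<tau> permutes {..<n} \<and>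
        (\<forall>\<Psi>\<in>S. unitary_mat n (U \<Psi>)) \<and>
        (\<forall>\<Psi>\<in>S. \<forall>i<n. \<forall>j<n. cmod (c \<Psi> i j) = 1) \<and>
        T = (\<lambda>\<Psi>. mat n n (\<lambda>(i, j). c \<Psi> i j \<cdot>\<^sub>v (U \<Psi> *\<^sub>v \<Psi> $$ (\<sigma> i, \<tau> j)))) ` S)"

text \<open>The fixed orthonormal basis is the standard one.\<close>

definition classical :: "nat \<Rightarrow> nat \<Rightarrow> complex vec mat set \<Rightarrow> bool" where
  "classical n t S \<longleftrightarrow>
     (\<exists>T. isotopic n t S T \<and>
          (\<forall>\<Phi>\<in>T. \<forall>i<n. \<forall>j<n. \<Phi> $$ (i, j) \<in> {unit_vec n k | k. k < n}))"

definition nonclassical_sizes :: "nat \<Rightarrow> nat set" where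
  "nonclassical_sizes n = {t. \<exists>S. moqls n t S \<and> \<not> classical n t S}"

text \<open>\<open>Max\<close> is unspecified on infinite sets, so any upper bound on this number includes the claim
  that the possible sizes are bounded.\<close>

definition max_nonclassical :: "nat \<Rightarrow> nat" where
  "max_nonclassical n = (if nonclassical_sizes n = {} then 0 else Max (nonclassical_sizes n))"

end

theory Submission
  imports Defs
begin

text \<open>Write \<open>g\<^sub>s c d\<close> for the inner product of the entries of the square \<open>s\<close> in the cells \<open>c\<close> and
  \<open>d\<close>. Orthogonality of two squares \<open>s\<close> and \<open>r\<close> means that \<open>g\<^sub>s c d\<close> and \<open>g\<^sub>r c d\<close> are never both
  nonzero for distinct cells. A set of squares is classical as soon as all \<open>g\<^sub>s c d\<close> have modulus \<open>0\<close>
  or \<open>1\<close> (\<open>classical_if_gram_0_or_1\<close>), since then each square uses, up to phases, only one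
  orthonormal basis. The core of the proof is that this holds for \<open>n - 2\<close> squares
  (\<open>gram_0_or_1\<close>).

  Fix a cell \<open>c\<close>. In any other row the squares have to share the \<open>n - 1\<close> cells outside the column of \<open>c\<close>,
  and each square needs at least one of them to expand its entry in \<open>c\<close>. So in each square the entry in \<open>c\<close>
  overlaps with at most two entries of the row (\<open>card_supp_le_2\<close>). Suppose that in the square \<open>s\<close> it
  overlaps with exactly two. These span a plane, and a support argument shows that in \<open>s\<close> every row
  contains exactly two entries in this plane, all others being orthogonal to it (\<open>row_V\<close>).

  Next, one plane cell per row can be chosen such that the chosen entries are pairwise non-orthogonal in \<open>s\<close>
  (\<open>transversal\<close>). In each of the \<open>n - 3\<close> other squares they are then pairwise orthogonal, so they
  form an orthonormal basis. If the choice avoids \<open>c\<close>, adding the squared overlaps of \<open>c\<close> with the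
  chosen cells over the other squares gives \<open>n - 3\<close>; but every row contributes at most \<open>1\<close>, and
  four rows contribute \<open>0\<close> (\<open>impossible\<close>).

  A larger set of squares reduces to its subsets of size \<open>n - 2\<close>, because the condition on \<open>g\<^sub>s\<close>
  concerns one square at a time (\<open>moqls_classical\<close>). This also bounds the sizes of non-classical sets.\<close>

section \<open>Inner products in mutually orthogonal quantum Latin squares\<close>

definition cells :: "nat \<Rightarrow> (nat \<times> nat) set" where
  "cells n = {..<n} \<times> {..<n}"

lemma mem_cells [simp]: "(i, j) \<in> cells n \<longleftrightarrow> i < n \<and> j < n"
  by (simp add: cells_def)

text \<open>The combinatorial part of the argument sees mutually orthogonal quantum Latin squares only through
  the inner products \<open>g s c d\<close> of the entries of the square \<open>s\<close> in the cells \<open>c\<close> and \<open>d\<close>. The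
  assumption \<open>expand\<close> says that any \<open>n\<close> cells whose entries are pairwise orthogonal carry an
  orthonormal basis; it will be applied to rows, to columns and to transversals. The assumption
  \<open>ortho\<close> is what orthogonality of two squares says about distinct cells: inner products of tensor
  products are products of inner products.\<close>

locale gram_family =
  fixes n :: nat and S :: "'s set"
    and g :: "'s \<Rightarrow> nat \<times> nat \<Rightarrow> nat \<times> nat \<Rightarrow> complex"
  assumes finite_S: "finite S" and card_S: "card S + 2 = n"
    and herm: "\<lbrakk>s \<in> S; c \<in> cells n; d \<in> cells n\<rbrakk> \<Longrightarrow> g s d c = cnj (g s c d)"
    and line_orthonormal: "\<lbrakk>s \<in> S; c \<in> cells n; d \<in> cells n; fst c = fst d \<or> snd c = snd d\<rbrakk>
                \<Longrightarrow> g s c d = (if c = d then 1 else 0)"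
    and expand: "\<lbrakk>s \<in> S; F \<subseteq> cells n; card F = n;
                  \<And>x y. \<lbrakk>x \<in> F; y \<in> F; x \<noteq> y\<rbrakk> \<Longrightarrow> g s x y = 0; c \<in> cells n; d \<in> cells n\<rbrakk>
                \<Longrightarrow> (\<Sum>x\<in>F. g s c x * g s x d) = g s c d"
    and ortho: "\<lbrakk>s \<in> S; r \<in> S; s \<noteq> r; c \<in> cells n; d \<in> cells n; c \<noteq> d\<rbrakk> \<Longrightarrow> g s c d = 0 \<or> g r c d = 0"
begin

abbreviation C :: "(nat \<times> nat) set" where
  "C \<equiv> cells n"

definition w :: "'s \<Rightarrow> nat \<times> nat \<Rightarrow> nat \<times> nat \<Rightarrow> real" where
  "w s c d = (cmod (g s c d))\<^sup>2"

lemma w_nonneg [simp]: "0 \<le> w s c d"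
  by (simp add: w_def)

lemma w_eq_0_iff [simp]: "w s c d = 0 \<longleftrightarrow> g s c d = 0"
  by (simp add: w_def)

lemma w_pos_iff: "0 < w s c d \<longleftrightarrow> g s c d \<noteq> 0"
  by (simp add: w_def)

lemma w_sym: "\<lbrakk>s \<in> S; c \<in> C; d \<in> C\<rbrakk> \<Longrightarrow> w s d c = w s c d"
  using herm[of s c d] by (simp add: w_def)

lemma g_sym_zero: "\<lbrakk>s \<in> S; c \<in> C; d \<in> C; g s c d = 0\<rbrakk> \<Longrightarrow> g s d c = 0"
  using herm[of s c d] by simp

lemma g_self: "\<lbrakk>s \<in> S; c \<in> C\<rbrakk> \<Longrightarrow> g s c c = 1"
  using line_orthonormal[of s c c] by simp

lemma parseval:
  assumes "s \<in> S" "F \<subseteq> C" "card F = n" "\<And>x y. \<lbrakk>x \<in> F; y \<in> F; x \<noteq> y\<rbrakk> \<Longrightarrow> g s x y = 0" "c \<in> C"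
  shows "(\<Sum>x\<in>F. w s c x) = 1"
proof -
  have "complex_of_real (\<Sum>x\<in>F. w s c x) = (\<Sum>x\<in>F. g s c x * g s x c)"
    unfolding of_real_sum
  proof (rule sum.cong[OF refl])
    fix x assume "x \<in> F"
    then have "g s x c = cnj (g s c x)"
      using assms herm[of s c x] by auto
    then show "complex_of_real (w s c x) = g s c x * g s x c"
      by (simp only: w_def complex_norm_square)
  qed
  also have "\<dots> = 1"
    using expand[OF assms(1-4) assms(5) assms(5)] g_self assms by simp
  finally show ?thesis
    using of_real_eq_1_iff by blast
qed

lemma row_expand:
  assumes "s \<in> S" "m < n" "c \<in> C" "d \<in> C"
  shows "(\<Sum>l<n. g s c (m, l) * g s (m, l) d) = g s c d"
proof -
  have "(\<Sum>x\<in>Pair m ` {..<n}. g s c x * g s x d) = g s c d"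
    by (rule expand) (use assms line_orthonormal in \<open>auto simp: card_image inj_on_def split: if_splits\<close>)
  then show ?thesis
    by (subst (asm) sum.reindex) (auto simp: inj_on_def)
qed

lemma row_sum:
  assumes "s \<in> S" "m < n" "c \<in> C"
  shows "(\<Sum>l<n. w s c (m, l)) = 1"
proof -
  have "(\<Sum>x\<in>Pair m ` {..<n}. w s c x) = 1"
    by (rule parseval) (use assms line_orthonormal in \<open>auto simp: card_image inj_on_def split: if_splits\<close>)
  then show ?thesis
    by (subst (asm) sum.reindex) (auto simp: inj_on_def)
qed

lemma column_sum:
  assumes "s \<in> S" "l < n" "c \<in> C"
  shows "(\<Sum>m<n. w s c (m, l)) = 1"
proof -
  have "(\<Sum>x\<in>(\<lambda>m. (m, l)) ` {..<n}. w s c x) = 1"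
    by (rule parseval) (use assms line_orthonormal in \<open>auto simp: card_image inj_on_def split: if_splits\<close>)
  then show ?thesis
    by (subst (asm) sum.reindex) (auto simp: inj_on_def)
qed

lemma w_le_1:
  assumes "s \<in> S" "c \<in> C" "d \<in> C"
  shows "w s c d \<le> 1"
proof -
  obtain m l where d: "d = (m, l)" "m < n" "l < n" using assms(3) by (cases d) auto
  have "w s c (m, l) \<le> (\<Sum>l<n. w s c (m, l))"
    using d by (intro member_le_sum) auto
  then show ?thesis using row_sum[of s m c] assms d by simp
qed

definition supp :: "'s \<Rightarrow> nat \<times> nat \<Rightarrow> nat \<Rightarrow> nat set" where
  "supp s c m = {l. l < n \<and> g s c (m, l) \<noteq> 0}"

lemma finite_supp [simp]: "finite (supp s c m)"
  by (simp add: supp_def)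

text \<open>In a row not containing \<open>c\<close>, every square needs a cell whose entry is not orthogonal to its
  entry in \<open>c\<close>. These cells differ for different squares, and none of them lies in the column of
  \<open>c\<close>. So \<open>n - 2\<close> squares share \<open>n - 1\<close> cells, each gets at least one, and no square gets more
  than two.\<close>

lemma card_supp_le_2:
  assumes s: "s \<in> S" and c: "c \<in> C" and m: "m < n"
  shows "card (supp s c m) \<le> 2"
proof -
  obtain i j where ij: "c = (i, j)" "i < n" "j < n" using c by (cases c) auto
  show ?thesis
  proof (cases "m = i")
    case True
    have "supp s c m \<subseteq> {j}"
      using line_orthonormal[OF s c] ij True by (auto simp: supp_def split: if_splits)
    then have "card (supp s c m) \<le> card {j}" by (intro card_mono) auto
    then show ?thesis by simp
  next
    case False
    have nonempty: "1 \<le> card (supp r c m)" if "r \<in> S" for r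
    proof -
      have "supp r c m \<noteq> {}"
      proof
        assume "supp r c m = {}"
        then have "(\<Sum>l<n. w r c (m, l)) = 0"
          by (intro sum.neutral) (auto simp: supp_def)
        then show False using row_sum[OF that m c] by simp
      qed
      then show ?thesis
        by (simp add: Suc_le_eq card_gt_0_iff)
    qed
    have "(\<Sum>r\<in>S. card (supp r c m)) = card (\<Union>r\<in>S. supp r c m)"
      using ortho c m ij False finite_S
      by (intro card_UN_disjoint[symmetric]) (fastforce simp: supp_def)+
    also have "\<dots> \<le> card ({..<n} - {j})"
      using line_orthonormal[OF _ c] ij m False
      by (intro card_mono) (auto simp: supp_def)
    also have "\<dots> = card S + 1"
      using ij card_S by simp
    finally have "card (supp s c m) + (\<Sum>r\<in>S - {s}. card (supp r c m)) \<le> card S + 1"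
      using sum.remove[OF finite_S s, of "\<lambda>r. card (supp r c m)"] by simp
    moreover have "card (S - {s}) \<le> (\<Sum>r\<in>S - {s}. card (supp r c m))"
      using nonempty sum_mono[of "S - {s}" "\<lambda>_. 1" "\<lambda>r. card (supp r c m)"] by simp
    ultimately show ?thesis using s finite_S by (simp add: card_Diff_singleton)
  qed
qed

end

section \<open>The plane spanned by two overlapping entries\<close>

lemma sum_two:
  fixes n e f :: nat
  assumes "\<And>l. \<lbrakk>l < n; l \<noteq> e; l \<noteq> f\<rbrakk> \<Longrightarrow> h l = (0 :: 'z :: comm_monoid_add)" "e < n" "f < n" "e \<noteq> f"
  shows "(\<Sum>l<n. h l) = h e + h f"
proof -
  have "(\<Sum>l<n. h l) = (\<Sum>l\<in>{e, f}. h l)"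
    using assms by (intro sum.mono_neutral_right) auto
  then show ?thesis using assms by simp
qed

text \<open>In a plane, orthogonality to a nonzero vector determines the direction: \<open>a\<close> and \<open>f\<close> are both
  orthogonal to \<open>e\<close>, hence parallel, so whatever is orthogonal to \<open>f\<close> is orthogonal to \<open>a\<close>.
  The second factors stand for conjugated coordinates.\<close>

lemma plane_orthogonal_chain:
  fixes a1 a2 e1 e2 f1 f2 b1 b2 :: complex
  assumes ae: "a1 * e1 + a2 * e2 = 0" and fe: "f1 * e1 + f2 * e2 = 0"
    and fb: "f1 * b1 + f2 * b2 = 0"
    and e: "e1 \<noteq> 0 \<or> e2 \<noteq> 0" and f: "f1 \<noteq> 0 \<or> f2 \<noteq> 0"
  shows "a1 * b1 + a2 * b2 = 0"
proof -
  have "e1 * (a1 * f2 - a2 * f1) = (a1 * e1 + a2 * e2) * f2 - (f1 * e1 + f2 * e2) * a2"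
    and "e2 * (a1 * f2 - a2 * f1) = (f1 * e1 + f2 * e2) * a1 - (a1 * e1 + a2 * e2) * f1"
    by (simp_all add: algebra_simps)
  then have "e1 * (a1 * f2 - a2 * f1) = 0" "e2 * (a1 * f2 - a2 * f1) = 0"
    using ae fe by simp_all
  then have af: "a1 * f2 = a2 * f1"
    using e by auto
  have "f1 * (a1 * b1 + a2 * b2) = a1 * (f1 * b1 + f2 * b2) + b2 * (a2 * f1 - a1 * f2)"
    and "f2 * (a1 * b1 + a2 * b2) = a2 * (f1 * b1 + f2 * b2) + b1 * (a1 * f2 - a2 * f1)"
    by (simp_all add: algebra_simps)
  then have "f1 * (a1 * b1 + a2 * b2) = 0" "f2 * (a1 * b1 + a2 * b2) = 0"
    using af fb by simp_all
  then show ?thesis using f by auto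
qed

text \<open>The situation to be excluded: in the square \<open>s\<close>, the entry in the cell \<open>(i, j)\<close> overlaps with
  two entries of row \<open>k\<close>. Those two entries span a plane, which turns out to be spanned by two
  entries of every row.\<close>

locale gram_plane = gram_family +
  fixes s :: 'a and i j k l1 l2 :: nat
  assumes s: "s \<in> S" and ij: "i < n" "j < n" and k: "k < n" and l: "l1 < n" "l2 < n" "l1 \<noteq> l2"
    and nz: "g s (i, j) (k, l1) \<noteq> 0" "g s (i, j) (k, l2) \<noteq> 0"
begin

text \<open>The cells whose entry in \<open>s\<close> lies in that plane: by the expansion in the basis given by row
  \<open>k\<close>, this means orthogonality to the remaining entries of that row.\<close>

definition V :: "(nat \<times> nat) set" where
  "V = {d \<in> C. \<forall>l<n. l \<noteq> l1 \<longrightarrow> l \<noteq> l2 \<longrightarrow> g s d (k, l) = 0}"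

lemma V_C: "d \<in> V \<Longrightarrow> d \<in> C"
  by (simp add: V_def)

lemma c_V: "(i, j) \<in> V"
proof -
  have "card {l1, l2} \<le> card (supp s (i, j) k)"
    using l nz by (intro card_mono) (auto simp: supp_def)
  then have "{l1, l2} = supp s (i, j) k"
    using l nz card_supp_le_2[OF s, of "(i, j)" k] ij k
    by (intro card_subset_eq) (auto simp: supp_def)
  then show ?thesis using ij by (auto simp: V_def supp_def)
qed

lemma V_expand:
  assumes "d \<in> V" "x \<in> C"
  shows "g s d x = g s d (k, l1) * g s (k, l1) x + g s d (k, l2) * g s (k, l2) x"
proof -
  have "(\<Sum>l<n. g s d (k, l) * g s (k, l) x)
          = g s d (k, l1) * g s (k, l1) x + g s d (k, l2) * g s (k, l2) x"
    using assms(1) l by (intro sum_two) (simp_all add: V_def)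
  then show ?thesis
    using row_expand[OF s k V_C[OF assms(1)] assms(2)] by simp
qed

lemma V_orthogonal_chain:
  assumes "a \<in> V" "e \<in> V" "f \<in> V" "b \<in> V"
    and "g s a e = 0" "g s e f = 0" "g s f b = 0"
  shows "g s a b = 0"
proof -
  have "g s f e = 0" using assms g_sym_zero s V_C by blast
  moreover have "g s (k, l1) e \<noteq> 0 \<or> g s (k, l2) e \<noteq> 0"
    using V_expand[of e e] assms V_C g_self[OF s, of e] by auto
  moreover have "g s f (k, l1) \<noteq> 0 \<or> g s f (k, l2) \<noteq> 0"
    using V_expand[of f f] assms V_C g_self[OF s, of f] by auto
  ultimately show ?thesis
    using assms V_C V_expand[of a e] V_expand[of f e] V_expand[of f b] V_expand[of a b]
      plane_orthogonal_chain[of "g s a (k, l1)" "g s (k, l1) e" "g s a (k, l2)" "g s (k, l2) e"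
         "g s f (k, l1)" "g s f (k, l2)" "g s (k, l1) b" "g s (k, l2) b"]
    by simp
qed

text \<open>The squared length of the projection of the entry onto the plane.\<close>

definition V_weight :: "nat \<times> nat \<Rightarrow> real" where
  "V_weight d = w s (k, l1) d + w s (k, l2) d"

lemma V_weight_bounds:
  assumes "d \<in> C"
  shows "V_weight d \<le> 1" and "V_weight d = 1 \<longleftrightarrow> d \<in> V"
proof -
  let ?rest = "\<Sum>l\<in>{..<n} - {l1, l2}. w s d (k, l)"
  have "(\<Sum>l<n. w s d (k, l)) = (\<Sum>l\<in>{l1, l2}. w s d (k, l)) + ?rest"
    using l by (subst sum.subset_diff[of "{l1, l2}"]) (auto simp: add.commute)
  then have eq: "V_weight d + ?rest = 1"
    using row_sum[OF s k assms] l w_sym[OF s assms, of "(k, l1)"] w_sym[OF s assms, of "(k, l2)"] k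
    by (simp add: V_weight_def)
  moreover have "0 \<le> ?rest" by (intro sum_nonneg) simp
  ultimately show "V_weight d \<le> 1" by simp
  have "?rest = 0 \<longleftrightarrow> (\<forall>l\<in>{..<n} - {l1, l2}. w s d (k, l) = 0)"
    by (intro sum_nonneg_eq_0_iff) auto
  then have "?rest = 0 \<longleftrightarrow> d \<in> V"
    using assms by (auto simp: V_def)
  then show "V_weight d = 1 \<longleftrightarrow> d \<in> V" using eq by auto
qed

text \<open>The plane is spanned by two entries in every row. Let \<open>u\<close> and \<open>v\<close> be the entries in
  \<open>(k, l1)\<close> and \<open>(k, l2)\<close>; it is enough that \<open>u\<close> and \<open>v\<close> together overlap with at most two
  entries of row \<open>m\<close>, since the total projection weight of a row on the plane is \<open>2\<close>. If \<open>u\<close> and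
  \<open>v\<close> have disjoint supports in row \<open>m\<close>, then nothing cancels in the combination of \<open>u\<close> and \<open>v\<close>
  that gives the entry in \<open>(i, j)\<close>, whose support has at most two elements. If the supports meet,
  they meet in at least two elements because \<open>u\<close> and \<open>v\<close> are orthogonal, so they coincide, as
  neither has more than two.\<close>

lemma row_V:
  assumes m: "m < n"
  obtains e f where "e < n" "f < n" "e \<noteq> f" "(m, e) \<in> V" "(m, f) \<in> V"
    and "\<And>l. \<lbrakk>l < n; l \<noteq> e; l \<noteq> f\<rbrakk> \<Longrightarrow> V_weight (m, l) = 0"
proof -
  let ?u = "(k, l1)" and ?v = "(k, l2)"
  let ?A = "supp s ?u m" and ?B = "supp s ?v m"
  have uv: "?u \<in> C" "?v \<in> C" using k l by auto
  have card_AB: "card (?A \<union> ?B) \<le> 2"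
  proof (cases "?A \<inter> ?B = {}")
    case True
    have "?A \<union> ?B \<subseteq> supp s (i, j) m"
    proof
      fix x assume x: "x \<in> ?A \<union> ?B"
      then have "g s ?u (m, x) = 0 \<or> g s ?v (m, x) = 0" "x < n"
        using True by (auto simp: supp_def)
      then have "g s (i, j) (m, x) \<noteq> 0"
        using x V_expand[OF c_V, of "(m, x)"] m nz by (auto simp: supp_def)
      then show "x \<in> supp s (i, j) m" using \<open>x < n\<close> by (simp add: supp_def)
    qed
    then have "card (?A \<union> ?B) \<le> card (supp s (i, j) m)" by (intro card_mono) auto
    then show ?thesis using card_supp_le_2[OF s _ m, of "(i, j)"] ij by simp
  next
    case False
    have "card (?A \<inter> ?B) \<noteq> 1"
    proof
      assume "card (?A \<inter> ?B) = 1"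
      then obtain x where x: "?A \<inter> ?B = {x}" by (auto simp: card_1_singleton_iff)
      then have xn: "x < n" by (auto simp: supp_def)
      have "0 = g s ?u ?v" using line_orthonormal[OF s uv] l by simp
      also have "\<dots> = (\<Sum>l<n. g s ?u (m, l) * g s (m, l) ?v)"
        using row_expand[OF s m uv] by simp
      also have "\<dots> = (\<Sum>l\<in>{x}. g s ?u (m, l) * g s (m, l) ?v)"
      proof (rule sum.mono_neutral_right)
        show "\<forall>l\<in>{..<n} - {x}. g s ?u (m, l) * g s (m, l) ?v = 0"
        proof
          fix l assume l: "l \<in> {..<n} - {x}"
          then have "l \<notin> ?A \<inter> ?B" using x by auto
          then show "g s ?u (m, l) * g s (m, l) ?v = 0"
            using l g_sym_zero[OF s uv(2), of "(m, l)"] m by (auto simp: supp_def)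
        qed
      qed (use xn in auto)
      finally have "g s ?u (m, x) = 0 \<or> g s (m, x) ?v = 0" by simp
      moreover have "g s ?u (m, x) \<noteq> 0" "g s ?v (m, x) \<noteq> 0"
        using x by (auto simp: supp_def)
      ultimately show False using g_sym_zero[OF s _ uv(2), of "(m, x)"] m xn by auto
    qed
    moreover have "card (?A \<inter> ?B) \<noteq> 0" using False by simp
    ultimately have two: "2 \<le> card (?A \<inter> ?B)" by linarith
    then have "?A \<inter> ?B = ?A" "?A \<inter> ?B = ?B"
      using card_supp_le_2[OF s uv(1) m] card_supp_le_2[OF s uv(2) m]
      by (intro card_seteq; simp)+
    then have "?A \<union> ?B = ?A" by blast
    then show ?thesis using card_supp_le_2[OF s uv(1) m] by simp
  qed
  have "2 \<le> card {..<n}" using l by simp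
  then obtain Z where Z: "?A \<union> ?B \<subseteq> Z" "Z \<subseteq> {..<n}" "card Z = 2"
    using exists_subset_between[OF card_AB, of "{..<n}"] by (auto simp: supp_def)
  then obtain e f where ef: "Z = {e, f}" "e \<noteq> f" by (auto simp: card_2_iff)
  have efn: "e < n" "f < n" using Z ef by auto
  have rest: "V_weight (m, x) = 0" if "x < n" "x \<noteq> e" "x \<noteq> f" for x
  proof -
    have "x \<notin> ?A" "x \<notin> ?B" using that Z ef by auto
    then show ?thesis using that(1) by (simp add: V_weight_def supp_def w_def)
  qed
  have "2 = (\<Sum>l<n. V_weight (m, l))"
    using row_sum[OF s m uv(1)] row_sum[OF s m uv(2)] by (simp add: V_weight_def sum.distrib)
  also have "\<dots> = V_weight (m, e) + V_weight (m, f)"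
    using rest efn ef by (intro sum_two) auto
  finally have "V_weight (m, e) = 1" "V_weight (m, f) = 1"
    using V_weight_bounds(1)[of "(m, e)"] V_weight_bounds(1)[of "(m, f)"] m efn by auto
  then show thesis
    using that[OF efn ef(2) _ _ rest] V_weight_bounds(2) m efn by simp
qed

lemma V_weight_0_if_not_V:
  assumes "d \<in> C" "d \<notin> V" shows "V_weight d = 0"
proof -
  obtain m x where d: "d = (m, x)" "m < n" "x < n" using assms by (cases d) auto
  show ?thesis using row_V[OF d(2)] d assms by metis
qed

lemma V_orthogonal_if_not_V:
  assumes "d \<in> C" "d \<notin> V" "x \<in> V"
  shows "g s x d = 0"
proof -
  have "w s (k, l1) d + w s (k, l2) d = 0"
    using V_weight_0_if_not_V[OF assms(1,2)] by (simp add: V_weight_def)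
  then have "w s (k, l1) d = 0" "w s (k, l2) d = 0"
    using w_nonneg[of s "(k, l1)" d] w_nonneg[of s "(k, l2)" d] by linarith+
  then show ?thesis using V_expand[OF assms(3,1)] by simp
qed

lemma row_partner:
  assumes "(m, x) \<in> V"
  obtains x' where "x' \<noteq> x" "(m, x') \<in> V" "\<And>y. (m, y) \<in> V \<Longrightarrow> y = x \<or> y = x'"
proof -
  have mx: "m < n" "x < n" using V_C[OF assms] by auto
  obtain e f where ef: "e < n" "f < n" "e \<noteq> f" "(m, e) \<in> V" "(m, f) \<in> V"
    and rest: "\<And>l. \<lbrakk>l < n; l \<noteq> e; l \<noteq> f\<rbrakk> \<Longrightarrow> V_weight (m, l) = 0"
    using row_V[OF mx(1)] by blast
  have "y = e \<or> y = f" if "(m, y) \<in> V" for y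
    using rest[of y] V_weight_bounds(2)[of "(m, y)"] that V_C[OF that] by auto
  with ef show thesis using that assms by metis
qed

text \<open>By Parseval's identity in column \<open>j\<close>, the projection weights of its cells on the plane add up to
  \<open>2\<close>, and each of them is \<open>0\<close> or \<open>1\<close>.\<close>

lemma column_partner:
  obtains i' where "i' \<noteq> i" "(i', j) \<in> V"
proof (rule ccontr)
  assume "\<not> thesis"
  then have no: "\<And>i'. i' \<noteq> i \<Longrightarrow> (i', j) \<notin> V" using that by blast
  have "2 = (\<Sum>m<n. V_weight (m, j))"
    using column_sum[OF s ij(2), of "(k, l1)"] column_sum[OF s ij(2), of "(k, l2)"] k l
    by (simp add: V_weight_def sum.distrib)
  also have "\<dots> = (\<Sum>m\<in>{i}. V_weight (m, j))"
    using no V_weight_0_if_not_V ij by (intro sum.mono_neutral_right) auto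
  also have "\<dots> = 1" using V_weight_bounds(2)[of "(i, j)"] c_V ij by simp
  finally show False by simp
qed

text \<open>One cell of the plane can be chosen in every row so that no two of the chosen entries are orthogonal in
  \<open>s\<close>. A new row offers two orthogonal entries of the plane. If both were unsuitable, two entries chosen
  earlier would be orthogonal to one of them each, hence orthogonal to one another. In every other
  square the chosen entries are pairwise orthogonal, so they form a basis there.\<close>

lemma transversal:
  assumes "(i, j') \<in> V"
  obtains f where "f i = j'" "\<And>m. m < n \<Longrightarrow> (m, f m) \<in> V"
    "\<And>m m'. \<lbrakk>m < n; m' < n\<rbrakk> \<Longrightarrow> g s (m, f m) (m', f m') \<noteq> 0"
proof -
  have "\<exists>f. f i = j' \<and> (\<forall>m\<in>insert i {..<N}. (m, f m) \<in> V \<and>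
              (\<forall>m'\<in>insert i {..<N}. g s (m, f m) (m', f m') \<noteq> 0))" if "N \<le> n" for N
    using that
  proof (induction N)
    case 0
    then show ?case
      using assms g_self[OF s V_C[OF assms]] by (intro exI[of _ "\<lambda>_. j'"]) simp
  next
    case (Suc N)
    then obtain f where f: "f i = j'"
      and fV: "\<And>m. m \<in> insert i {..<N} \<Longrightarrow> (m, f m) \<in> V"
      and fnz: "\<And>m m'. \<lbrakk>m \<in> insert i {..<N}; m' \<in> insert i {..<N}\<rbrakk>
                  \<Longrightarrow> g s (m, f m) (m', f m') \<noteq> 0"
      by auto
    show ?case
    proof (cases "N = i")
      case True
      then have "insert i {..<Suc N} = insert i {..<N}" by auto
      then show ?thesis using f fV fnz by metis
    next
      case False
      have "N < n" using Suc by simp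
      then obtain x y where xy: "(N, x) \<in> V" "(N, y) \<in> V" "x \<noteq> y"
        using row_V by metis
      have "\<exists>z. (N, z) \<in> V \<and> (\<forall>m\<in>insert i {..<N}. g s (m, f m) (N, z) \<noteq> 0)"
      proof (rule ccontr)
        assume "\<not> ?thesis"
        then have no: "\<exists>m\<in>insert i {..<N}. g s (m, f m) (N, z) = 0" if "(N, z) \<in> V" for z
          using that by blast
        obtain a b where ab: "a \<in> insert i {..<N}" "b \<in> insert i {..<N}"
          "g s (a, f a) (N, x) = 0" "g s (b, f b) (N, y) = 0"
          using no[OF xy(1)] no[OF xy(2)] by (elim bexE) (rule that)
        have "g s (N, x) (N, y) = 0" using line_orthonormal[OF s] xy V_C by auto
        moreover have "g s (N, y) (b, f b) = 0"
          using g_sym_zero[OF s V_C[OF fV[OF ab(2)]] V_C[OF xy(2)] ab(4)] .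
        ultimately have "g s (a, f a) (b, f b) = 0"
          using V_orthogonal_chain[of "(a, f a)" "(N, x)" "(N, y)" "(b, f b)"] fV[OF ab(1)] fV[OF ab(2)] ab(3) xy by simp
        then show False using fnz[OF ab(1) ab(2)] by simp
      qed
      then obtain z where z: "(N, z) \<in> V" "\<And>m. m \<in> insert i {..<N} \<Longrightarrow> g s (m, f m) (N, z) \<noteq> 0"
        by blast
      have z': "g s (N, z) (m, f m) \<noteq> 0" if "m \<in> insert i {..<N}" for m
        using z(2)[OF that] g_sym_zero[OF s V_C[OF z(1)] V_C[OF fV[OF that]]] by blast
      have "g s (N, z) (N, z) \<noteq> 0" using g_self[OF s V_C[OF z(1)]] by simp
      then show ?thesis
        using f fV fnz z z' False
        by (intro exI[of _ "f(N := z)"]) (auto simp: less_Suc_eq)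
    qed
  qed
  from this[of n] show thesis using that ij by auto
qed

text \<open>Double counting along a transversal whose cell in row \<open>i\<close> is not \<open>(i, j)\<close>. In each of the
  \<open>n - 3\<close> other squares the transversal is an orthonormal basis, so the squared overlaps with the entry in
  \<open>(i, j)\<close> add up to \<open>1\<close>, which gives \<open>n - 3\<close> in total. On the other hand each cell of the
  transversal contributes at most \<open>1\<close>, as only one square can have a nonzero overlap there, and four
  rows contribute nothing: row \<open>i\<close>; the other row whose plane cell lies in column \<open>j\<close>; and two rows,
  \<open>k\<close> among them, in which the overlap in \<open>s\<close> is already nonzero. So the total is at most
  \<open>n - 4\<close>.\<close>

lemma impossible: False
proof -
  obtain j' where j': "j' \<noteq> j" "(i, j') \<in> V" using row_partner[OF c_V] by blast
  obtain f where fi: "f i = j'" and fV: "\<And>m. m < n \<Longrightarrow> (m, f m) \<in> V"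
    and fnz: "\<And>m m'. \<lbrakk>m < n; m' < n\<rbrakk> \<Longrightarrow> g s (m, f m) (m', f m') \<noteq> 0"
    using transversal[OF j'(2)] by blast
  have c: "(i, j) \<in> C" using ij by simp
  have fC: "(m, f m) \<in> C" if "m < n" for m using V_C[OF fV[OF that]] .
  have c_ne: "(i, j) \<noteq> (m, f m)" for m using fi j' by auto
  let ?T = "\<lambda>m. \<Sum>r\<in>S - {s}. w r (i, j) (m, f m)"
  have total: "(\<Sum>m<n. ?T m) = real n - 3"
  proof -
    have "(\<Sum>m<n. w r (i, j) (m, f m)) = 1" if r: "r \<in> S - {s}" for r
    proof -
      have "(\<Sum>x\<in>(\<lambda>m. (m, f m)) ` {..<n}. w r (i, j) x) = 1"
      proof (rule parseval)
        show "g r x y = 0" if "x \<in> (\<lambda>m. (m, f m)) ` {..<n}" "y \<in> (\<lambda>m. (m, f m)) ` {..<n}" "x \<noteq> y"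
          for x y
          using that r fnz fC ortho[OF s, of r x y] by auto
        show "(\<lambda>m. (m, f m)) ` {..<n} \<subseteq> C"
          using fC by blast
      qed (use r c in \<open>auto simp: card_image inj_on_def\<close>)
      then show ?thesis by (subst (asm) sum.reindex) (auto simp: inj_on_def)
    qed
    then have "(\<Sum>m<n. ?T m) = real (card (S - {s}))"
      by (subst sum.swap) simp
    also have "\<dots> = real n - 3"
    proof -
      have "card (S - {s}) + 3 = n" using card_S s finite_S card_Suc_Diff1[OF finite_S s] by simp
      then show ?thesis by (auto simp: algebra_simps)
    qed
    finally show ?thesis .
  qed
  have T_le_1: "?T m \<le> 1" if m: "m < n" for m
  proof (cases "\<exists>r\<in>S - {s}. g r (i, j) (m, f m) \<noteq> 0")
    case True
    then obtain r where r: "r \<in> S - {s}" "g r (i, j) (m, f m) \<noteq> 0" by blast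
    have "?T m = (\<Sum>q\<in>{r}. w q (i, j) (m, f m))"
      using r finite_S ortho[OF _ _ _ c fC[OF m] c_ne]
      by (intro sum.mono_neutral_right) auto
    then show ?thesis using w_le_1[OF _ c fC[OF m]] r by simp
  next
    case False
    then have "?T m = 0" by (intro sum.neutral) simp
    then show ?thesis by simp
  qed
  have T_nz: "?T m = 0" if "m < n" "g s (i, j) (m, f m) \<noteq> 0" for m
    using that ortho[OF s _ _ c fC[OF that(1)] c_ne] by (intro sum.neutral) auto
  have T_line: "?T m = 0" if "m < n" "m = i \<or> f m = j" for m
    using that line_orthonormal[OF _ c fC[OF that(1)]] c_ne[of m] by (intro sum.neutral) auto
  \<comment> \<open>The other plane cell \<open>(i', j)\<close> of column \<open>j\<close> is orthogonal to \<open>(i, j)\<close>, hence parallel to \<open>(i, j')\<close>,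
      and therefore the transversal has to pass through it.\<close>
  obtain i' where i': "i' \<noteq> i" "(i', j) \<in> V" using column_partner by blast
  have i'n: "i' < n" using V_C[OF i'(2)] by simp
  have fi': "f i' = j"
  proof (rule ccontr)
    assume ne: "f i' \<noteq> j"
    have "g s (i, j') (i, j) = 0" "g s (i, j) (i', j) = 0" "g s (i', j) (i', f i') = 0"
      using line_orthonormal[OF s] V_C[OF j'(2)] c V_C[OF i'(2)] fC[OF i'n] j' i' ne by auto
    then have "g s (i, j') (i', f i') = 0"
      using V_orthogonal_chain j' c_V i' fV[OF i'n] by blast
    then show False using fnz[OF ij(1) i'n] fi by simp
  qed
  have k_nz: "g s (i, j) (k, f k) \<noteq> 0"
  proof -
    have "f k = l1 \<or> f k = l2"
      using fV[OF k] fC[OF k] g_self[OF s fC[OF k]] by (auto simp: V_def)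
    then show ?thesis using nz by auto
  qed
  have less: "w s (i, j) (k, l1) < 1"
  proof -
    have "w s (i, j) (k, l1) + w s (i, j) (k, l2) = (\<Sum>l\<in>{l1, l2}. w s (i, j) (k, l))"
      using l by simp
    also have "\<dots> \<le> (\<Sum>l<n. w s (i, j) (k, l))"
      using l by (intro sum_mono2) auto
    also have "\<dots> = 1" by (rule row_sum[OF s k c])
    finally show ?thesis using nz(2) w_pos_iff[of s "(i, j)" "(k, l2)"] by simp
  qed
  \<comment> \<open>The overlap with \<open>(k, l1)\<close> is strictly between \<open>0\<close> and \<open>1\<close>, so column \<open>l1\<close> has a second
      cell of this kind, and its row \<open>k'\<close> is again one in which \<open>(i, j)\<close> overlaps with both plane
      cells.\<close>
  obtain k' where k': "k' < n" "k' \<noteq> k" "g s (i, j) (k', l1) \<noteq> 0"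
  proof (rule ccontr)
    assume "\<not> thesis"
    then have "(\<Sum>m<n. w s (i, j) (m, l1)) = (\<Sum>m\<in>{k}. w s (i, j) (m, l1))"
      using k that by (intro sum.mono_neutral_right) auto
    then show False using column_sum[OF s l(1) c] less by simp
  qed
  have k'_nz: "g s (i, j) (k', f k') \<noteq> 0"
  proof -
    have "w s (i, j) (k', l1) + w s (i, j) (k, l1) = (\<Sum>m\<in>{k, k'}. w s (i, j) (m, l1))"
      using k' by simp
    also have "\<dots> \<le> (\<Sum>m<n. w s (i, j) (m, l1))"
      using k k' by (intro sum_mono2) auto
    also have "\<dots> = 1" by (rule column_sum[OF s l(1) c])
    finally have less': "w s (i, j) (k', l1) < 1"
      using nz(1) w_pos_iff[of s "(i, j)" "(k, l1)"] by simp
    obtain l3 where l3: "l3 < n" "l3 \<noteq> l1" "g s (i, j) (k', l3) \<noteq> 0"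
    proof (rule ccontr)
      assume "\<not> thesis"
      then have "(\<Sum>x<n. w s (i, j) (k', x)) = (\<Sum>x\<in>{l1}. w s (i, j) (k', x))"
        using l that by (intro sum.mono_neutral_right) auto
      then show False using row_sum[OF s k'(1) c] less' by simp
    qed
    have "(k', l1) \<in> V" "(k', l3) \<in> V"
      using V_orthogonal_if_not_V[OF _ _ c_V] k' l l3 by (metis mem_cells)+
    then have "f k' = l1 \<or> f k' = l3"
      using row_partner[of k' l1] fV[OF k'(1)] l3 by metis
    then show ?thesis using k' l3 by auto
  qed
  have zero_i: "g s (i, j) (i, f i) = 0"
    using line_orthonormal[OF s c fC[OF ij(1)]] c_ne[of i] by simp
  have zero_i': "g s (i, j) (i', f i') = 0"
    using line_orthonormal[OF s c fC[OF i'n]] c_ne[of i'] fi' by simp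
  let ?Z = "{i, i', k, k'}"
  have "card ?Z = 4"
    using i' k' zero_i zero_i' k_nz k'_nz by (auto simp: card_insert_if)
  moreover have Z: "?Z \<subseteq> {..<n}" using ij i'n k k' by auto
  ultimately have card_rest: "card ({..<n} - ?Z) + 4 = n"
    using card_mono[OF _ Z] by (simp add: card_Diff_subset)
  have "(\<Sum>m<n. ?T m) = (\<Sum>m\<in>{..<n} - ?Z. ?T m)"
    using Z T_nz[OF k k_nz] T_nz[OF k'(1) k'_nz] T_line[OF ij(1)] T_line[OF i'n] fi'
    by (intro sum.mono_neutral_right) auto
  also have "\<dots> \<le> (\<Sum>m\<in>{..<n} - ?Z. 1)"
    using T_le_1 by (intro sum_mono) auto
  also have "\<dots> = real n - 4"
    using card_rest by auto
  finally show False using total by simp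
qed

end

context gram_family
begin

text \<open>If \<open>d\<close> is the only cell of its row that overlaps with \<open>c\<close>, Parseval's identity gives modulus
  one; two such cells are excluded.\<close>

lemma gram_0_or_1:
  assumes s: "s \<in> S" and c: "c \<in> C" and d: "d \<in> C" and nz: "g s c d \<noteq> 0"
  shows "cmod (g s c d) = 1"
proof -
  obtain i j k l1 where cd: "c = (i, j)" "d = (k, l1)" by (cases c, cases d) auto
  have "g s c (k, l2) = 0" if "l2 < n" "l2 \<noteq> l1" for l2
  proof (rule ccontr)
    assume "g s c (k, l2) \<noteq> 0"
    then interpret gram_plane n S g s i j k l1 l2
      using s c d nz cd that by unfold_locales simp_all
    show False by (rule impossible)
  qed
  then have "(\<Sum>x<n. w s c (k, x)) = (\<Sum>x\<in>{l1}. w s c (k, x))"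
    using d cd by (intro sum.mono_neutral_right) auto
  then have "w s c d = 1"
    using row_sum[OF s _ c, of k] d cd by simp
  then show ?thesis
    using power2_eq_imp_eq[of "cmod (g s c d)" 1] by (simp add: w_def)
qed

end

section \<open>Orthonormal bases and tensor products in coordinates\<close>

text \<open>An indexed version of orthonormality. In contrast to a set of vectors it excludes repetitions,
  which makes it suitable for counting cells.\<close>

definition orthonormal_family :: "nat \<Rightarrow> 'i set \<Rightarrow> ('i \<Rightarrow> complex vec) \<Rightarrow> bool" where
  "orthonormal_family d I f \<longleftrightarrow>
     (\<forall>x\<in>I. f x \<in> carrier_vec d) \<and> (\<forall>x\<in>I. \<forall>y\<in>I. f x \<bullet>c f y = (if x = y then 1 else 0))"

lemma cscalar_prod_sum:
  "v \<in> carrier_vec d \<Longrightarrow> u \<bullet>c v = (\<Sum>p<d. u $ p * cnj (v $ p))" for u v :: "complex vec"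
  by (simp add: scalar_prod_def lessThan_atLeast0)

lemma cscalar_prod_cnj:
  "\<lbrakk>u \<in> carrier_vec d; v \<in> carrier_vec d\<rbrakk> \<Longrightarrow> v \<bullet>c u = cnj (u \<bullet>c v)" for u v :: "complex vec"
  by (simp add: cscalar_prod_sum[of _ d] mult.commute)

lemma mult_mat_entry:
  "\<lbrakk>i < a; k < c\<rbrakk> \<Longrightarrow> (mat a b F * mat b c G) $$ (i, k) = (\<Sum>j<b. F (i, j) * G (j, k))"
  by (simp add: scalar_prod_def lessThan_atLeast0)

text \<open>Orthonormality says that a square matrix with rows \<open>f l\<close> has its adjoint as right inverse; a
  right inverse of a square matrix is also a left inverse, which is the claim read entrywise.\<close>

lemma orthonormal_family_completeness:
  assumes "orthonormal_family d {..<d} f" "p < d" "q < d"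
  shows "(\<Sum>l<d. f l $ p * cnj (f l $ q)) = (if p = q then 1 else 0)"
proof -
  let ?A = "mat d d (\<lambda>(l, p). f l $ p)" and ?B = "mat d d (\<lambda>(p, l). cnj (f l $ p))"
  have "?A * ?B = 1\<^sub>m d"
  proof (rule eq_matI)
    fix l m assume "l < dim_row (1\<^sub>m d :: complex mat)" "m < dim_col (1\<^sub>m d :: complex mat)"
    then have lm: "l < d" "m < d" by auto
    then have "(?A * ?B) $$ (l, m) = (\<Sum>p<d. f l $ p * cnj (f m $ p))"
      by (subst mult_mat_entry) auto
    also have "\<dots> = f l \<bullet>c f m"
      using assms lm by (subst cscalar_prod_sum[of _ d]) (auto simp: orthonormal_family_def)
    also have "\<dots> = 1\<^sub>m d $$ (l, m)"
      using assms lm by (simp add: orthonormal_family_def)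
    finally show "(?A * ?B) $$ (l, m) = 1\<^sub>m d $$ (l, m)" .
  qed auto
  then have "?B * ?A = 1\<^sub>m d"
    by (rule mat_mult_left_right_inverse[rotated 2]) auto
  then have "(?B * ?A) $$ (q, p) = (if p = q then 1 else 0)"
    using assms by simp
  then show ?thesis
    using assms by (subst (asm) mult_mat_entry) (auto simp: mult.commute)
qed

lemma orthonormal_family_reindex:
  assumes "orthonormal_family d I f" "bij_betw h J I"
  shows "orthonormal_family d J (f \<circ> h)"
proof -
  have "h x \<in> I" if "x \<in> J" for x using bij_betwE[OF assms(2)] that by blast
  moreover have "h x = h y \<longleftrightarrow> x = y" if "x \<in> J" "y \<in> J" for x y
    using assms(2) that by (auto simp: bij_betw_def inj_on_def)
  ultimately show ?thesis using assms(1) by (simp add: orthonormal_family_def)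
qed

lemma orthonormal_family_expand:
  assumes f: "orthonormal_family d I f" and I: "finite I" "card I = d"
    and a: "a \<in> carrier_vec d" and b: "b \<in> carrier_vec d"
  shows "(\<Sum>x\<in>I. (a \<bullet>c f x) * (f x \<bullet>c b)) = a \<bullet>c b"
proof -
  obtain h where h: "bij_betw h {..<d} I"
    using ex_bij_betw_nat_finite[OF I(1)] I(2) by (auto simp: lessThan_atLeast0)
  let ?e = "f \<circ> h"
  have e: "orthonormal_family d {..<d} ?e"
    by (rule orthonormal_family_reindex[OF f h])
  have "(\<Sum>x\<in>I. (a \<bullet>c f x) * (f x \<bullet>c b)) = (\<Sum>l<d. (a \<bullet>c ?e l) * (?e l \<bullet>c b))"
    using sum.reindex_bij_betw[OF h, of "\<lambda>x. (a \<bullet>c f x) * (f x \<bullet>c b)"] by simp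
  also have "\<dots> = (\<Sum>l<d. (\<Sum>q<d. a $ q * cnj (?e l $ q)) * (\<Sum>p<d. ?e l $ p * cnj (b $ p)))"
    using e b by (intro sum.cong) (auto simp: cscalar_prod_sum[of _ d] orthonormal_family_def)
  also have "\<dots> = (\<Sum>l<d. \<Sum>q<d. \<Sum>p<d. a $ q * cnj (b $ p) * (?e l $ p * cnj (?e l $ q)))"
    by (simp only: sum_product) (simp add: ac_simps)
  also have "\<dots> = (\<Sum>q<d. \<Sum>p<d. \<Sum>l<d. a $ q * cnj (b $ p) * (?e l $ p * cnj (?e l $ q)))"
    by (subst sum.swap, rule sum.cong[OF refl], rule sum.swap)
  also have "\<dots> = (\<Sum>q<d. \<Sum>p<d. a $ q * cnj (b $ p) * (if p = q then 1 else 0))"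
    using orthonormal_family_completeness[OF e] by (simp add: sum_distrib_left[symmetric])
  also have "\<dots> = (\<Sum>q<d. a $ q * cnj (b $ q))"
    by (simp add: if_distrib[of "\<lambda>x. _ * x"] cong: if_cong)
  also have "\<dots> = a \<bullet>c b"
    using cscalar_prod_sum[OF b] by simp
  finally show ?thesis .
qed

lemma orthonormal_family_basis:
  assumes f: "orthonormal_family d {..<d} f"
  shows "vectorspace.basis class_ring (module_vec TYPE(complex) d) (f ` {..<d})"
proof -
  interpret vec_space "TYPE(complex)" d .
  let ?A = "mat d d (\<lambda>(l, p). f l $ p)" and ?B = "mat d d (\<lambda>(p, l). cnj (f l $ p))"
  have fc: "f l \<in> carrier_vec d" if "l < d" for l
    using f that by (simp add: orthonormal_family_def)
  have rows: "set (rows ?A) = f ` {..<d}"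
  proof -
    have "row ?A l = f l" if "l < d" for l
      using fc[OF that] that by (intro eq_vecI) auto
    then show ?thesis by (auto simp: rows_def)
  qed
  have "?B * ?A = 1\<^sub>m d"
  proof (rule eq_matI)
    fix q p assume "q < dim_row (1\<^sub>m d :: complex mat)" "p < dim_col (1\<^sub>m d :: complex mat)"
    then have "q < d" "p < d" by auto
    then show "(?B * ?A) $$ (q, p) = 1\<^sub>m d $$ (q, p)"
      using orthonormal_family_completeness[OF f, of p q]
      by (subst mult_mat_entry) (auto simp: mult.commute)
  qed auto
  then have "det ?B * det ?A = 1"
    using det_mult[of ?B d ?A] by simp
  then have "det ?A \<noteq> 0" by auto
  then have "lin_indpt (f ` {..<d})"
    using det_not_0_imp_lin_indpt_rows[of ?A] rows by simp
  moreover have "inj_on f {..<d}"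
    using f by (intro inj_onI) (metis orthonormal_family_def zero_neq_one)
  ultimately show ?thesis
    using fc by (intro dim_li_is_basis) (auto simp: card_image dim_is_n)
qed

text \<open>A basis of a space of dimension \<open>d\<close> has \<open>d\<close> elements, so an enumeration of it by \<open>d\<close> indices
  has no repetitions. Conversely, \<open>d\<close> orthonormal vectors form a basis.\<close>

lemma orthonormal_basis_image_iff:
  assumes I: "finite I" "card I = d"
  shows "orthonormal_basis d (f ` I) \<longleftrightarrow> orthonormal_family d I f"
proof
  assume B: "orthonormal_basis d (f ` I)"
  interpret vec_space "TYPE(complex)" d .
  have bas: "basis (f ` I)" using B by (simp add: orthonormal_basis_def)
  then have "card (f ` I) = card I"
    using dim_basis[of "f ` I"] I dim_is_n by simp
  then have "inj_on f I" using I by (simp add: eq_card_imp_inj_on)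
  moreover have "f ` I \<subseteq> carrier_vec d" using bas by (simp add: basis_def)
  ultimately show "orthonormal_family d I f"
    using B by (auto simp: orthonormal_basis_def orthonormal_family_def inj_on_def)
next
  assume f: "orthonormal_family d I f"
  obtain h where h: "bij_betw h {..<d} I"
    using ex_bij_betw_nat_finite[OF I(1)] I(2) by (auto simp: lessThan_atLeast0)
  have "(f \<circ> h) ` {..<d} = f ` I"
    using h by (simp only: image_comp[symmetric] bij_betw_imp_surj_on)
  then have "vectorspace.basis class_ring (module_vec TYPE(complex) d) (f ` I)"
    using orthonormal_family_basis[OF orthonormal_family_reindex[OF f h]] by simp
  moreover have "f x \<bullet>c f y = (if f x = f y then 1 else 0)" if "x \<in> I" "y \<in> I" for x y
    using f that unfolding orthonormal_family_def by (metis (no_types, opaque_lifting))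
  ultimately show "orthonormal_basis d (f ` I)"
    by (auto simp: orthonormal_basis_def)
qed

lemma sum_div_mod:
  fixes F G :: "nat \<Rightarrow> 'z :: comm_semiring_0"
  shows "(\<Sum>k<m * n. F (k div n) * G (k mod n)) = (\<Sum>a<m. F a) * (\<Sum>b<n. G b)"
proof -
  have "(\<Sum>k<m * n. F (k div n) * G (k mod n))
          = (\<Sum>a<m. \<Sum>k = a * n..<a * n + n. F (k div n) * G (k mod n))"
    by (simp add: sum.nat_group)
  also have "\<dots> = (\<Sum>a<m. \<Sum>b<n. F a * G b)"
  proof (rule sum.cong[OF refl])
    fix a
    have "(\<Sum>k = a * n..<a * n + n. F (k div n) * G (k mod n))
            = (\<Sum>b = 0..<n. F ((b + a * n) div n) * G ((b + a * n) mod n))"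
      using sum.shift_bounds_nat_ivl[of "\<lambda>k. F (k div n) * G (k mod n)" 0 "a * n" n]
      by (simp add: add.commute)
    then show "(\<Sum>k = a * n..<a * n + n. F (k div n) * G (k mod n)) = (\<Sum>b<n. F a * G b)"
      by (simp add: lessThan_atLeast0)
  qed
  finally show ?thesis by (simp add: sum_product)
qed

lemma tensor_vec_carrier:
  "\<lbrakk>u \<in> carrier_vec m; v \<in> carrier_vec n\<rbrakk> \<Longrightarrow> u \<otimes>\<^sub>v v \<in> carrier_vec (m * n)"
  by (auto simp: tensor_vec_def)

lemma tensor_vec_cscalar_prod:
  assumes "u \<in> carrier_vec m" "u' \<in> carrier_vec m" "v \<in> carrier_vec n" "v' \<in> carrier_vec n"
  shows "(u \<otimes>\<^sub>v v) \<bullet>c (u' \<otimes>\<^sub>v v') = (u \<bullet>c u') * (v \<bullet>c v')"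
proof -
  have "(u \<otimes>\<^sub>v v) \<bullet>c (u' \<otimes>\<^sub>v v')
          = (\<Sum>k<m * n. (u $ (k div n) * cnj (u' $ (k div n))) * (v $ (k mod n) * cnj (v' $ (k mod n))))"
    using assms
    by (subst cscalar_prod_sum[OF tensor_vec_carrier]) (auto simp: tensor_vec_def ac_simps)
  also have "\<dots> = (u \<bullet>c u') * (v \<bullet>c v')"
    using assms sum_div_mod[of "\<lambda>p. u $ p * cnj (u' $ p)" n "\<lambda>p. v $ p * cnj (v' $ p)" m]
    by (simp add: cscalar_prod_sum[of _ m] cscalar_prod_sum[of _ n])
  finally show ?thesis .
qed

section \<open>Quantum Latin squares in terms of inner products\<close>

abbreviation gram :: "complex vec mat \<Rightarrow> nat \<times> nat \<Rightarrow> nat \<times> nat \<Rightarrow> complex" where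
  "gram \<Psi> c d \<equiv> \<Psi> $$ c \<bullet>c \<Psi> $$ d"

text \<open>Apart from the format of the matrix, being a quantum Latin square is a property of the inner products
  of the entries, and so is orthogonality of two squares. In this form both are easily seen to be
  preserved by unitary maps and phases.\<close>

lemma quantum_latin_square_iff_gram:
  "quantum_latin_square n \<Psi> \<longleftrightarrow>
     \<Psi> \<in> carrier_mat n n \<and> (\<forall>c\<in>cells n. \<Psi> $$ c \<in> carrier_vec n) \<and>
     (\<forall>c\<in>cells n. \<forall>d\<in>cells n. fst c = fst d \<or> snd c = snd d \<longrightarrow> gram \<Psi> c d = (if c = d then 1 else 0))"
proof -
  have row: "orthonormal_basis n {\<Psi> $$ (i, j) | j. j < n} \<longleftrightarrow> orthonormal_family n {..<n} (\<lambda>j. \<Psi> $$ (i, j))" for i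
    using orthonormal_basis_image_iff[of "{..<n}" n "\<lambda>j. \<Psi> $$ (i, j)"]
    by (simp add: image_def lessThan_def) (simp add: Collect_ex_eq[symmetric] conj_commute)
  have col: "orthonormal_basis n {\<Psi> $$ (i, j) | i. i < n} \<longleftrightarrow> orthonormal_family n {..<n} (\<lambda>i. \<Psi> $$ (i, j))" for j
    using orthonormal_basis_image_iff[of "{..<n}" n "\<lambda>i. \<Psi> $$ (i, j)"]
    by (simp add: image_def lessThan_def) (simp add: Collect_ex_eq[symmetric] conj_commute)
  show ?thesis
    unfolding quantum_latin_square_def row col
    by (auto simp: orthonormal_family_def cells_def)
qed

lemma orthogonal_qls_iff_gram:
  assumes "quantum_latin_square n \<Psi>" "quantum_latin_square n \<Phi>"
  shows "orthogonal_qls n \<Psi> \<Phi> \<longleftrightarrow>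
     (\<forall>c\<in>cells n. \<forall>d\<in>cells n. gram \<Psi> c d * gram \<Phi> c d = (if c = d then 1 else 0))"
proof -
  have eq: "{\<Psi> $$ (i, j) \<otimes>\<^sub>v \<Phi> $$ (i, j) | i j. i < n \<and> j < n} = (\<lambda>c. \<Psi> $$ c \<otimes>\<^sub>v \<Phi> $$ c) ` cells n"
    by (auto simp: cells_def)
  have "orthogonal_qls n \<Psi> \<Phi> \<longleftrightarrow> orthonormal_family (n * n) (cells n) (\<lambda>c. \<Psi> $$ c \<otimes>\<^sub>v \<Phi> $$ c)"
    unfolding orthogonal_qls_def eq
    by (intro orthonormal_basis_image_iff) (auto simp: cells_def)
  then show ?thesis
    using assms tensor_vec_carrier[of _ n _ n] tensor_vec_cscalar_prod[of _ n _ _ n]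
    by (simp add: orthonormal_family_def quantum_latin_square_iff_gram)
qed

lemma moqls_gram_family:
  assumes S: "moqls n t S" and t: "t + 2 = n"
  shows "gram_family n S gram"
proof
  show "finite S" "card S + 2 = n" using S t by (auto simp: moqls_def)
next
  fix \<Psi> c d assume "\<Psi> \<in> S" "c \<in> cells n" "d \<in> cells n"
  then show "gram \<Psi> d c = cnj (gram \<Psi> c d)"
    using S by (intro cscalar_prod_cnj) (auto simp: moqls_def quantum_latin_square_iff_gram)
next
  fix \<Psi> c d assume "\<Psi> \<in> S" "c \<in> cells n" "d \<in> cells n" "fst c = fst d \<or> snd c = snd d"
  then show "gram \<Psi> c d = (if c = d then 1 else 0)"
    using S by (auto simp: moqls_def quantum_latin_square_iff_gram)
next
  fix \<Psi> F c d
  assume *: "\<Psi> \<in> S" "F \<subseteq> cells n" "card F = n" "c \<in> cells n" "d \<in> cells n"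
    and orth: "\<And>x y. \<lbrakk>x \<in> F; y \<in> F; x \<noteq> y\<rbrakk> \<Longrightarrow> gram \<Psi> x y = 0"
  have q: "\<forall>c\<in>cells n. \<Psi> $$ c \<in> carrier_vec n" "\<forall>c\<in>cells n. gram \<Psi> c c = 1"
    using S * by (auto simp: moqls_def quantum_latin_square_iff_gram)
  have "orthonormal_family n F (\<lambda>c. \<Psi> $$ c)"
    using q * orth by (auto simp: orthonormal_family_def)
  moreover have "finite F" using * finite_subset by (fastforce simp: cells_def)
  ultimately show "(\<Sum>x\<in>F. gram \<Psi> c x * gram \<Psi> x d) = gram \<Psi> c d"
    using q * by (intro orthonormal_family_expand) auto
next
  fix \<Psi> \<Phi> c d
  assume *: "\<Psi> \<in> S" "\<Phi> \<in> S" "\<Psi> \<noteq> \<Phi>" "c \<in> cells n" "d \<in> cells n" "c \<noteq> d"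
  then have "orthogonal_qls n \<Psi> \<Phi>" "quantum_latin_square n \<Psi>" "quantum_latin_square n \<Phi>"
    using S by (auto simp: moqls_def)
  then have "gram \<Psi> c d * gram \<Phi> c d = 0"
    using * by (simp add: orthogonal_qls_iff_gram)
  then show "gram \<Psi> c d = 0 \<or> gram \<Phi> c d = 0" by simp
qed

section \<open>Classicality\<close>

text \<open>The matrix that maps the orthonormal basis \<open>f\<close> to the standard basis: its rows are the
  conjugates of the \<open>f l\<close>, so that the coordinates of the image of \<open>x\<close> are the inner products of \<open>x\<close> with
  the \<open>f l\<close>.\<close>

definition basis_change :: "nat \<Rightarrow> (nat \<Rightarrow> complex vec) \<Rightarrow> complex mat" where
  "basis_change n f = mat n n (\<lambda>(l, p). cnj (f l $ p))"

lemma basis_change_mult_vec: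
  assumes "orthonormal_family n {..<n} f" "x \<in> carrier_vec n"
  shows "basis_change n f *\<^sub>v x = vec n (\<lambda>l. x \<bullet>c f l)"
proof (rule eq_vecI)
  fix l assume "l < dim_vec (vec n (\<lambda>l. x \<bullet>c f l))"
  then have l: "l < n" by simp
  then have "f l \<in> carrier_vec n" using assms by (simp add: orthonormal_family_def)
  then show "(basis_change n f *\<^sub>v x) $ l = vec n (\<lambda>l. x \<bullet>c f l) $ l"
    using l assms(2) by (simp add: basis_change_def scalar_prod_def mult.commute)
qed (simp add: basis_change_def)

lemma basis_change_cscalar_prod:
  assumes f: "orthonormal_family n {..<n} f" and x: "x \<in> carrier_vec n" and y: "y \<in> carrier_vec n"
  shows "(basis_change n f *\<^sub>v x) \<bullet>c (basis_change n f *\<^sub>v y) = x \<bullet>c y"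
proof -
  have "(basis_change n f *\<^sub>v x) \<bullet>c (basis_change n f *\<^sub>v y) = (\<Sum>l<n. (x \<bullet>c f l) * cnj (y \<bullet>c f l))"
    using assms by (simp add: basis_change_mult_vec cscalar_prod_sum[of _ n])
  also have "\<dots> = (\<Sum>l<n. (x \<bullet>c f l) * (f l \<bullet>c y))"
    using f y cscalar_prod_cnj[of y n] by (intro sum.cong) (auto simp: orthonormal_family_def)
  also have "\<dots> = x \<bullet>c y"
    using assms by (intro orthonormal_family_expand) auto
  finally show ?thesis .
qed

lemma unitary_basis_change:
  assumes f: "orthonormal_family n {..<n} f"
  shows "unitary_mat n (basis_change n f)"
proof -
  let ?U = "basis_change n f"
  have adj: "mat_adjoint ?U = mat n n (\<lambda>(p, l). f l $ p)"
    by (intro eq_matI) (auto simp: mat_adjoint_def basis_change_def mat_of_rows_def)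
  have "mat n n (\<lambda>(p, l). f l $ p) * ?U = 1\<^sub>m n"
  proof (rule eq_matI)
    fix p q assume "p < dim_row (1\<^sub>m n :: complex mat)" "q < dim_col (1\<^sub>m n :: complex mat)"
    then have "p < n" "q < n" by auto
    then show "(mat n n (\<lambda>(p, l). f l $ p) * ?U) $$ (p, q) = 1\<^sub>m n $$ (p, q)"
      using orthonormal_family_completeness[OF f, of p q]
      unfolding basis_change_def by (subst mult_mat_entry) auto
  qed (auto simp: basis_change_def)
  then have "mat_adjoint ?U * ?U = 1\<^sub>m n" by (simp only: adj)
  moreover have carrier: "?U \<in> carrier_mat n n" "mat_adjoint ?U \<in> carrier_mat n n"
    unfolding adj by (simp_all add: basis_change_def)
  ultimately show ?thesis
    using mat_mult_left_right_inverse[OF carrier(2,1)] by (simp add: unitary_mat_def)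
qed

lemma quantum_latin_square_row_parseval:
  assumes "quantum_latin_square n \<Psi>" "c \<in> cells n" "m < n"
  shows "(\<Sum>l<n. gram \<Psi> c (m, l) * gram \<Psi> (m, l) c) = 1"
proof -
  have "orthonormal_family n {..<n} (\<lambda>l. \<Psi> $$ (m, l))"
    using assms by (auto simp: orthonormal_family_def quantum_latin_square_iff_gram)
  then have "(\<Sum>l<n. gram \<Psi> c (m, l) * gram \<Psi> (m, l) c) = gram \<Psi> c c"
    using assms by (intro orthonormal_family_expand) (auto simp: quantum_latin_square_iff_gram)
  then show ?thesis
    using assms by (simp add: quantum_latin_square_iff_gram)
qed

text \<open>Unitary maps and phases change the inner products only by phases, and this is enough to preserve
  mutual orthogonality. The number of squares is preserved as well: two orthogonal squares with the
  same image would have the same inner products up to phases. For distinct cells these could not be nonzero in both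
  squares, so they would all vanish, whereas the entry in \<open>(0, 0)\<close> cannot be orthogonal to the
  whole of row \<open>1\<close>.\<close>

lemma moqls_image_if_gram_phase_equal:
  assumes S: "moqls n t S" and n: "n \<ge> 2"
    and F: "\<And>\<Psi>. \<Psi> \<in> S \<Longrightarrow> F \<Psi> \<in> carrier_mat n n"
    and Fc: "\<And>\<Psi> c. \<lbrakk>\<Psi> \<in> S; c \<in> cells n\<rbrakk> \<Longrightarrow> F \<Psi> $$ c \<in> carrier_vec n"
    and gram_F: "\<And>\<Psi> c d. \<lbrakk>\<Psi> \<in> S; c \<in> cells n; d \<in> cells n\<rbrakk>
                   \<Longrightarrow> gram (F \<Psi>) c d = a \<Psi> c * cnj (a \<Psi> d) * gram \<Psi> c d"
    and a: "\<And>\<Psi> c. \<lbrakk>\<Psi> \<in> S; c \<in> cells n\<rbrakk> \<Longrightarrow> cmod (a \<Psi> c) = 1"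
  shows "moqls n t (F ` S)"
proof -
  have qls: "quantum_latin_square n \<Psi>" if "\<Psi> \<in> S" for \<Psi>
    using S that by (simp add: moqls_def)
  have orth: "gram \<Psi> c d * gram \<Phi> c d = (if c = d then 1 else 0)"
    if "\<Psi> \<in> S" "\<Phi> \<in> S" "\<Psi> \<noteq> \<Phi>" "c \<in> cells n" "d \<in> cells n" for \<Psi> \<Phi> c d
    using S that qls by (simp add: moqls_def orthogonal_qls_iff_gram)
  have aa: "a \<Psi> c * cnj (a \<Psi> c) = 1" if "\<Psi> \<in> S" "c \<in> cells n" for \<Psi> c
    using a[OF that] complex_norm_square[of "a \<Psi> c"] by simp
  have a0: "a \<Psi> c \<noteq> 0" if "\<Psi> \<in> S" "c \<in> cells n" for \<Psi> c
    using a[OF that] by auto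
  have F_qls: "quantum_latin_square n (F \<Psi>)" if "\<Psi> \<in> S" for \<Psi>
    using qls[OF that] F[OF that] Fc[OF that] gram_F[OF that] aa[OF that]
    by (auto simp: quantum_latin_square_iff_gram)
  have F_gram: "gram (F \<Psi>) c d * gram (F \<Phi>) c d = (if c = d then 1 else 0)"
    if "\<Psi> \<in> S" "\<Phi> \<in> S" "\<Psi> \<noteq> \<Phi>" "c \<in> cells n" "d \<in> cells n" for \<Psi> \<Phi> c d
  proof -
    have "gram (F \<Psi>) c d * gram (F \<Phi>) c d
            = (a \<Psi> c * cnj (a \<Psi> d)) * (a \<Phi> c * cnj (a \<Phi> d)) * (gram \<Psi> c d * gram \<Phi> c d)"
      using that gram_F by (simp add: ac_simps)
    then show ?thesis
      using orth[OF that] aa[OF that(1,5)] aa[OF that(2,5)] by simp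
  qed
  have inj: "inj_on F S"
  proof (rule inj_onI, rule ccontr)
    fix \<Psi> \<Phi> assume *: "\<Psi> \<in> S" "\<Phi> \<in> S" "F \<Psi> = F \<Phi>" "\<Psi> \<noteq> \<Phi>"
    have zero: "gram \<Psi> (0, 0) (1, l) = 0" if "l < n" for l
    proof -
      have cd: "(0, 0) \<in> cells n" "(1, l) \<in> cells n" using n that by auto
      have "gram (F \<Psi>) (0, 0) (1, l) * gram (F \<Psi>) (0, 0) (1, l) = 0"
        using F_gram[OF *(1,2,4) cd] *(3) by simp
      then show ?thesis
        using gram_F[OF *(1) cd] a0[OF *(1) cd(1)] a0[OF *(1) cd(2)] by simp
    qed
    show False
      using quantum_latin_square_row_parseval[OF qls[OF *(1)], of "(0, 0)" 1] n zero by simp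
  qed
  have F_orth: "orthogonal_qls n (F \<Psi>) (F \<Phi>)" if "\<Psi> \<in> S" "\<Phi> \<in> S" "F \<Psi> \<noteq> F \<Phi>" for \<Psi> \<Phi>
  proof -
    have "\<Psi> \<noteq> \<Phi>" using that(3) by blast
    then show ?thesis
      unfolding orthogonal_qls_iff_gram[OF F_qls[OF that(1)] F_qls[OF that(2)]]
      using F_gram[OF that(1,2)] by blast
  qed
  have "finite (F ` S)" "card (F ` S) = t"
    using S inj by (simp_all add: moqls_def card_image)
  then show ?thesis
    using F_qls F_orth unfolding moqls_def by blast
qed

text \<open>If inner products have modulus \<open>0\<close> or \<open>1\<close>, each entry is a multiple of an entry of row \<open>0\<close>.
  Mapping row \<open>0\<close> of each square to the standard basis makes all entries multiples of standard basis
  vectors, and phases remove the factors; rows and columns stay in place.\<close>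

lemma classical_if_gram_0_or_1:
  assumes S: "moqls n t S" and n: "n \<ge> 2"
    and norm_1: "\<And>\<Psi> c d. \<lbrakk>\<Psi> \<in> S; c \<in> cells n; d \<in> cells n; gram \<Psi> c d \<noteq> 0\<rbrakk> \<Longrightarrow> cmod (gram \<Psi> c d) = 1"
  shows "classical n t S"
proof -
  let ?f = "\<lambda>\<Psi> l. \<Psi> $$ (0, l)"
  let ?U = "\<lambda>\<Psi>. basis_change n (?f \<Psi>)"
  \<comment> \<open>Only one summand is nonzero, so the sum is the coefficient of the entry with respect to row \<open>0\<close>;
      its conjugate is its inverse.\<close>
  let ?a = "\<lambda>\<Psi> i j. cnj (\<Sum>l<n. gram \<Psi> (i, j) (0, l))"
  let ?F = "\<lambda>\<Psi>. mat n n (\<lambda>(i, j). ?a \<Psi> i j \<cdot>\<^sub>v (?U \<Psi> *\<^sub>v \<Psi> $$ (id i, id j)))"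
  have qls: "quantum_latin_square n \<Psi>" if "\<Psi> \<in> S" for \<Psi>
    using S that by (simp add: moqls_def)
  have carrier: "\<Psi> $$ c \<in> carrier_vec n" if "\<Psi> \<in> S" "c \<in> cells n" for \<Psi> c
    using qls[OF that(1)] that(2) by (simp add: quantum_latin_square_iff_gram)
  have f: "orthonormal_family n {..<n} (?f \<Psi>)" if "\<Psi> \<in> S" for \<Psi>
    using qls[OF that] n by (auto simp: orthonormal_family_def quantum_latin_square_iff_gram)
  have single: "\<exists>k<n. \<forall>l<n. (gram \<Psi> (i, j) (0, l) \<noteq> 0) = (l = k)"
    if "\<Psi> \<in> S" "i < n" "j < n" for \<Psi> i j
  proof -
    let ?g = "\<lambda>l. gram \<Psi> (i, j) (0, l)" and ?K = "{l. l < n \<and> gram \<Psi> (i, j) (0, l) \<noteq> 0}"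
    have ij: "(i, j) \<in> cells n" using that by simp
    have term1: "?g l * gram \<Psi> (0, l) (i, j) = (if l \<in> ?K then 1 else 0)" if "l < n" for l
    proof -
      have c: "(0, l) \<in> cells n" using n that by simp
      have "?g l * gram \<Psi> (0, l) (i, j) = ?g l * cnj (?g l)"
        using cscalar_prod_cnj[OF carrier[OF \<open>\<Psi> \<in> S\<close> ij] carrier[OF \<open>\<Psi> \<in> S\<close> c]] by simp
      also have "\<dots> = complex_of_real ((cmod (?g l))\<^sup>2)"
        by (simp only: complex_norm_square)
      also have "\<dots> = (if l \<in> ?K then 1 else 0)"
        using norm_1[OF \<open>\<Psi> \<in> S\<close> ij c] that by auto
      finally show ?thesis .
    qed
    have "1 = (\<Sum>l<n. ?g l * gram \<Psi> (0, l) (i, j))"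
      using quantum_latin_square_row_parseval[OF qls[OF that(1)] ij, of 0] n by simp
    also have "\<dots> = (\<Sum>l<n. if l \<in> ?K then 1 else 0)"
      using term1 by simp
    also have "\<dots> = of_nat (card ?K)"
      by (subst sum.inter_filter[symmetric]) (auto intro!: arg_cong[of _ _ card])
    finally have "card ?K = 1" using of_nat_eq_1_iff[where 'a = complex] by metis
    then obtain k where "?K = {k}" by (auto simp: card_1_singleton_iff)
    then show ?thesis by (intro exI[of _ k]) blast
  qed
  have entry: "\<exists>k<n. cmod (?a \<Psi> i j) = 1 \<and> ?F \<Psi> $$ (i, j) = unit_vec n k"
    if \<Psi>: "\<Psi> \<in> S" and ij: "i < n" "j < n" for \<Psi> i j
  proof -
    let ?g = "\<lambda>l. gram \<Psi> (i, j) (0, l)"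
    obtain k where k: "k < n" and gk: "\<And>l. l < n \<Longrightarrow> (?g l \<noteq> 0) = (l = k)"
      using single[OF \<Psi> ij] by blast
    have "(\<Sum>l<n. ?g l) = (\<Sum>l\<in>{k}. ?g l)"
      using k gk by (intro sum.mono_neutral_right) auto
    then have a: "?a \<Psi> i j = cnj (?g k)" by simp
    have norm: "cmod (?g k) = 1"
      using norm_1[OF \<Psi>, of "(i, j)" "(0, k)"] gk[OF k] ij k n by simp
    have "?F \<Psi> $$ (i, j) = ?a \<Psi> i j \<cdot>\<^sub>v vec n ?g"
      using ij basis_change_mult_vec[OF f[OF \<Psi>] carrier[OF \<Psi>, of "(i, j)"]] by simp
    also have "\<dots> = unit_vec n k"
    proof (rule eq_vecI)
      fix l assume "l < dim_vec (unit_vec n k :: complex vec)"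
      then have l: "l < n" by simp
      have "cnj (?g k) * ?g k = 1"
        using norm complex_norm_square[of "?g k"] by (simp add: mult.commute)
      then have "cnj (?g k) * ?g l = (if l = k then 1 else 0)"
        using gk[OF l] by auto
      then show "(?a \<Psi> i j \<cdot>\<^sub>v vec n ?g) $ l = unit_vec n k $ l"
        unfolding a using l k by simp
    qed simp
    finally show ?thesis
      using k norm a by auto
  qed
  have "moqls n t (?F ` S)"
  proof (rule moqls_image_if_gram_phase_equal[OF S n, where a = "\<lambda>\<Psi> (i, j). ?a \<Psi> i j"])
    fix \<Psi> c assume \<Psi>: "\<Psi> \<in> S" and c: "c \<in> cells n"
    obtain i j where ij: "c = (i, j)" "i < n" "j < n" using c by (cases c) auto
    show "?F \<Psi> $$ c \<in> carrier_vec n"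
      using ij basis_change_mult_vec[OF f[OF \<Psi>] carrier[OF \<Psi> c]] by simp
    show "cmod (case c of (i, j) \<Rightarrow> ?a \<Psi> i j) = 1"
      using entry[OF \<Psi> ij(2,3)] ij by auto
  next
    fix \<Psi> c d assume \<Psi>: "\<Psi> \<in> S" and c: "c \<in> cells n" and d: "d \<in> cells n"
    obtain i j where ij: "c = (i, j)" "i < n" "j < n" using c by (cases c) auto
    obtain k l where kl: "d = (k, l)" "k < n" "l < n" using d by (cases d) auto
    let ?x = "?U \<Psi> *\<^sub>v \<Psi> $$ c" and ?y = "?U \<Psi> *\<^sub>v \<Psi> $$ d"
    have xy: "?x \<in> carrier_vec n" "?y \<in> carrier_vec n"
      using basis_change_mult_vec[OF f[OF \<Psi>]] carrier[OF \<Psi>] c d by simp_all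
    have "gram (?F \<Psi>) c d = (?a \<Psi> i j \<cdot>\<^sub>v ?x) \<bullet>c (?a \<Psi> k l \<cdot>\<^sub>v ?y)"
      using ij kl by simp
    also have "\<dots> = ?a \<Psi> i j * cnj (?a \<Psi> k l) * (?x \<bullet>c ?y)"
      using xy by (simp add: conjugate_smult_vec)
    also have "?x \<bullet>c ?y = gram \<Psi> c d"
      by (rule basis_change_cscalar_prod[OF f[OF \<Psi>] carrier[OF \<Psi> c] carrier[OF \<Psi> d]])
    finally show "gram (?F \<Psi>) c d
        = (case c of (i, j) \<Rightarrow> ?a \<Psi> i j) * cnj (case d of (i, j) \<Rightarrow> ?a \<Psi> i j) * gram \<Psi> c d"
      using ij kl by simp
  qed simp
  moreover have "\<forall>\<Psi>\<in>S. unitary_mat n (?U \<Psi>)"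
    using f unitary_basis_change by blast
  moreover have "\<forall>\<Psi>\<in>S. \<forall>i<n. \<forall>j<n. cmod (?a \<Psi> i j) = 1"
    using entry by blast
  ultimately have "isotopic n t S (?F ` S)"
    unfolding isotopic_def using S permutes_id[of "{..<n}"]
    by (intro conjI exI[of _ id] exI[of _ ?U] exI[of _ ?a]) auto
  moreover have "\<forall>\<Phi>\<in>?F ` S. \<forall>i<n. \<forall>j<n. \<Phi> $$ (i, j) \<in> {unit_vec n k | k. k < n}"
    using entry by blast
  ultimately show ?thesis
    unfolding classical_def by blast
qed

lemma moqls_subset:
  assumes "moqls n t S" "R \<subseteq> S"
  shows "moqls n (card R) R"
  using assms finite_subset[of R S] unfolding moqls_def by blast

text \<open>Whether the inner products in one square have modulus \<open>0\<close> or \<open>1\<close> can be decided within any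
  \<open>n - 2\<close> of the squares that include it. This extends the case of \<open>n - 2\<close> squares to all
  larger sets, as needed for a bound on the size of non-classical sets.\<close>

lemma moqls_classical:
  assumes n: "n \<ge> 3" and t: "n - 2 \<le> t" and S: "moqls n t S"
  shows "classical n t S"
proof (rule classical_if_gram_0_or_1[OF S])
  fix \<Psi> c d assume *: "\<Psi> \<in> S" "c \<in> cells n" "d \<in> cells n" "gram \<Psi> c d \<noteq> 0"
  have "1 \<le> n - 2" using n by simp
  then obtain R where R: "{\<Psi>} \<subseteq> R" "R \<subseteq> S" "card R = n - 2"
    using exists_subset_between[of "{\<Psi>}" "n - 2" S] t S *(1) by (auto simp: moqls_def)
  interpret gram_family n R gram
    using moqls_gram_family[OF moqls_subset[OF S R(2)]] R(3) n by simp
  show "cmod (gram \<Psi> c d) = 1"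
    using gram_0_or_1 * R(1) by simp
qed (use n in simp)

theorem theorem5:
  fixes n :: nat
  assumes "n \<ge> 3"
  shows "(\<forall>S. moqls n (n - 2) S \<longrightarrow> classical n (n - 2) S) \<and> max_nonclassical n \<le> n - 3"
proof
  show "\<forall>S. moqls n (n - 2) S \<longrightarrow> classical n (n - 2) S"
    using moqls_classical assms by simp
  have "nonclassical_sizes n \<subseteq> {..n - 3}"
  proof
    fix t assume "t \<in> nonclassical_sizes n"
    then obtain S where "moqls n t S" "\<not> classical n t S"
      by (auto simp: nonclassical_sizes_def)
    then have "\<not> n - 2 \<le> t" using moqls_classical assms by blast
    then show "t \<in> {..n - 3}" by simp
  qed
  then show "max_nonclassical n \<le> n - 3"
    using finite_subset[of "nonclassical_sizes n" "{..n - 3}"] Max_in[of "nonclassical_sizes n"]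
    by (auto simp: max_nonclassical_def)
qed

end
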